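(* Let $\omega$ be a non-quasianalytic weight function and $\mathfrak{M}=\mathfrak{M}_\omega$. Then the derived families $\mathfrak{K}=\mathfrak{K}(\mathfrak{M})$ and $\underline{\mathfrak{L}}=\{\underline L(M):M\in\mathfrak{M}\}$ are R-equivalent.
   Context: A pre-weight function is a continuous increasing $\omega:[0,\infty)\to[0,\infty)$ with $\omega(0)=0$, $\omega(t)\to\infty$, $\log t=o(\omega(t))$, and $t\mapsto\omega(e^t)$ convex; a weight function additionally has $\omega(2t)=O(\omega(t))$; non-quasianalytic if $\int_0^\infty\omega(t)/(1+t^2)dt<\infty$; normalized if $\omega|_{[0,1]}=0$; equivalent if each is $O$ of the other at $\infty$. $\varphi^*_\omega(x)=\sup_{y\ge0}(xy-\omega(e^y))$, $\kappa_\omega(t)=\int_1^\infty\omega(ts)s^{-2}ds$. $\mathfrak{M}_\omega=\{M^{(x)}:x>0\}$, $M^{(x)}_k=\exp(\frac1x\varphi^*_\omega(xk))$ ($\omega$ normalized). For a weight sequence $M_k=\mu_0\cdots\mu_k$: $\omega_M(t)=\sup_k\log(t^kM_0/M_k)$, $\widetilde\omega_M=\omega_M+\log(1+t^2)$, log-convex minorant $\underline P_k=P_0\sup_{t\ge0}t^ke^{-\omega_P(t)}$ of a positive sequence $P$. $\mathfrak{K}=\{K^{(\alpha)}\}$ with $K^{(\alpha)}_j=\exp(\varphi^*_{\kappa_\alpha}(j))$, $\kappa_\alpha=\kappa_{\widetilde\omega_{M^{(\alpha)}}}$ replaced by an equivalent normalized function; $L(M)_0=1$, $L(M)_k=\min_{0\le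 j<k}(k/\sum_{\ell\ge k}\mu_\ell^{-1})^{k-j}M_j$, and $\underline L(M)$ its log-convex minorant. $M\preceq N$ iff $\sup_{k\ge1}(M_k/N_k)^{1/k}<\infty$; families are R-equivalent if each member of either is $\preceq$ some member of the other.
   Formalization: The equivalent normalized function replacing κ_α is required to differ from κ_α by a bounded amount on [0,∞); for arbitrary equivalent choices (e.g. ακ_α with ω(t)=(max(0,log t))²) the claim fails. *)

theory Defs
  imports "HOL-Analysis.Analysis" "HOL-Library.Landau_Symbols"
begin

definition pre_weight :: "(real \<Rightarrow> real) \<Rightarrow> bool" where
  "pre_weight \<omega> \<longleftrightarrow>
     continuous_on {0..} \<omega> \<and> mono_on {0..} \<omega> \<and> (\<forall>t\<ge>0. \<omega> t \<ge> 0) \<and>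
     \<omega> 0 = 0 \<and> filterlim \<omega> at_top at_top \<and>
     (\<lambda>t. ln t) \<in> o[at_top](\<omega>) \<and>
     convex_on UNIV (\<lambda>t. \<omega> (exp t))"

definition weight_fun :: "(real \<Rightarrow> real) \<Rightarrow> bool" where
  "weight_fun \<omega> \<longleftrightarrow> pre_weight \<omega> \<and> (\<lambda>t. \<omega> (2 * t)) \<in> O[at_top](\<omega>)"

definition non_quasianalytic :: "(real \<Rightarrow> real) \<Rightarrow> bool" where
  "non_quasianalytic \<omega> \<longleftrightarrow> (\<lambda>t. \<omega> t / (1 + t\<^sup>2)) integrable_on {0..}"

definition normalized :: "(real \<Rightarrow> real) \<Rightarrow> bool" where
  "normalized \<omega> \<longleftrightarrow> (\<forall>t\<in>{0..1}. \<omega> t = 0)"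

definition phi_star :: "(real \<Rightarrow> real) \<Rightarrow> real \<Rightarrow> real" where
  "phi_star \<omega> x = (SUP y\<in>{0..}. x * y - \<omega> (exp y))"

definition kappa :: "(real \<Rightarrow> real) \<Rightarrow> real \<Rightarrow> real" where
  "kappa \<omega> t = integral {1..} (\<lambda>s. \<omega> (t * s) / s\<^sup>2)"

definition Mx :: "(real \<Rightarrow> real) \<Rightarrow> real \<Rightarrow> nat \<Rightarrow> real" where
  "Mx \<omega> x k = exp (phi_star \<omega> (x * real k) / x)"

definition Mfam :: "(real \<Rightarrow> real) \<Rightarrow> (nat \<Rightarrow> real) set" where
  "Mfam \<omega> = {Mx \<omega> x | x. x > 0}"

text \<open>Associated function \<open>\<omega>\<^sub>M(t) = sup_k log(t^k M_0/M_k)\<close> (with \<open>0^0 = 1\<close>).\<close>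
definition omega_seq :: "(nat \<Rightarrow> real) \<Rightarrow> real \<Rightarrow> real" where
  "omega_seq M t = ln (SUP k. t ^ k * M 0 / M k)"

definition omega_tilde :: "(nat \<Rightarrow> real) \<Rightarrow> real \<Rightarrow> real" where
  "omega_tilde M t = omega_seq M t + ln (1 + t\<^sup>2)"

definition lc_minorant :: "(nat \<Rightarrow> real) \<Rightarrow> nat \<Rightarrow> real" where
  "lc_minorant P k = P 0 * (SUP t\<in>{0..}. t ^ k * exp (- omega_seq P t))"

text \<open>Quotients \<open>\<mu>_k = M_k / M_{k-1}\<close>, so that \<open>M_k = \<mu>_0 \<cdots> \<mu>_k\<close> with \<open>\<mu>_0 = M_0\<close>.\<close>
definition mu :: "(nat \<Rightarrow> real) \<Rightarrow> nat \<Rightarrow> real" where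
  "mu M k = (if k = 0 then M 0 else M k / M (k - 1))"

definition Lseq :: "(nat \<Rightarrow> real) \<Rightarrow> nat \<Rightarrow> real" where
  "Lseq M k = (if k = 0 then 1 else
     Min ((\<lambda>j. (real k / (\<Sum>l. 1 / mu M (l + k))) ^ (k - j) * M j) ` {0..<k}))"

definition Lfam :: "(real \<Rightarrow> real) \<Rightarrow> (nat \<Rightarrow> real) set" where
  "Lfam \<omega> = {lc_minorant (Lseq M) | M. M \<in> Mfam \<omega>}"

text \<open>\<open>\<kappa>_\<alpha> = \<kappa>_{\<omega>~_{M^(\<alpha>)}}\<close> (before normalization).\<close>
definition kappa_alpha :: "(real \<Rightarrow> real) \<Rightarrow> real \<Rightarrow> real \<Rightarrow> real" where
  "kappa_alpha \<omega> \<alpha> = kappa (omega_tilde (Mx \<omega> \<alpha>))"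

text \<open>Family \<open>\<KK>\<close> built from a chosen normalized replacement \<open>\<kappa>'\<close> of the \<open>\<kappa>_\<alpha>\<close>.\<close>
definition Kfam :: "(real \<Rightarrow> real \<Rightarrow> real) \<Rightarrow> (nat \<Rightarrow> real) set" where
  "Kfam \<kappa>' = {(\<lambda>j. exp (phi_star (\<kappa>' \<alpha>) (real j))) | \<alpha>. \<alpha> > 0}"

definition seq_le :: "(nat \<Rightarrow> real) \<Rightarrow> (nat \<Rightarrow> real) \<Rightarrow> bool" (infix "\<preceq>\<^sub>s" 50) where
  "M \<preceq>\<^sub>s N \<longleftrightarrow> bdd_above ((\<lambda>k. (M k / N k) powr (1 / real k)) ` {1..})"

definition R_equiv :: "(nat \<Rightarrow> real) set \<Rightarrow> (nat \<Rightarrow> real) set \<Rightarrow> bool" where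
  "R_equiv F G \<longleftrightarrow> (\<forall>M\<in>F. \<exists>N\<in>G. M \<preceq>\<^sub>s N) \<and> (\<forall>N\<in>G. \<exists>M\<in>F. N \<preceq>\<^sub>s M)"

end

(* For a log-convex M with quotients mu_1 <= mu_2 <= ..., put n = #{k. mu_k <= t} and
   b = t * sum_{k>n} 1/mu_k. Writing omega_M(t) as the sum of the positive parts of
   log(t/mu_k) and integrating termwise gives kappa_{omega_M}(t) = omega_M(t) + n + b.
   On the other hand omega_{L(M)}(t) is the supremum over j < k of
   (k-j) log((t/k) sum_{l>=k} 1/mu_l) + log(t^j/M_j). Hence
     omega_{L(M)}(t) <= 2 kappa_{omega_M}(t)  and
     kappa_{omega_M}(t) <= 18 omega_{L(M)}(e t) + C,
   where the lower bound takes j = n-1, k = n, or, if b dominates n, j = n and k close to n + b/8.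
   The multiplicative constants are absorbed by moving inside the weight matrix: the powers
   (M^(ma)_k)^m = M^(a)_{mk} give m omega_{M^(ma)} <= omega_{M^(a)} for natural m. The dilation by e
   costs only a factor e^k in the k-th term, which the relation between sequences ignores. *)

theory Submission
  imports Defs "HOL-Real_Asymp.Real_Asymp"
begin

section \<open>Positive part of the logarithm and its integral against
  \<open>1 / s\<^sup>2\<close>\<close>

definition log_plus :: "real \<Rightarrow> real" where
  "log_plus u = max 0 (ln u)"

text \<open>Closed form of \<open>kappa log_plus x\<close> for positive \<open>x\<close>,
  established just below.\<close>

definition kappa_log_plus :: "real \<Rightarrow> real" where
  "kappa_log_plus x = (if x \<ge> 1 then 1 + ln x else x)"

lemma log_plus_nonneg [simp]: "0 \<le> log_plus u"
  by (simp add: log_plus_def)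

lemma log_plus_eq_0: "0 \<le> u \<Longrightarrow> u \<le> 1 \<Longrightarrow> log_plus u = 0"
  \<comment> \<open>At \<open>u = 0\<close> the convention \<open>ln 0 = 0\<close> gives the
    value.\<close>
  by (cases "u = 0") (auto simp: log_plus_def)

lemma log_plus_eq_ln: "1 \<le> u \<Longrightarrow> log_plus u = ln u"
  by (simp add: log_plus_def)

lemma ln_le_log_plus: "ln u \<le> log_plus u"
  by (simp add: log_plus_def)

lemma has_integral_log_plus:
  assumes "x > 0"
  shows "((\<lambda>s. log_plus (x * s) / s\<^sup>2) has_integral kappa_log_plus x) {1..}"
proof -
  \<comment> \<open>From \<open>a\<close> on, \<open>x * s\<close> is at least 1 and the logarithm
    is its own positive part; between 1 and \<open>a\<close> the integrand vanishes.\<close>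
  define a where "a = max 1 (1 / x)"
  have a: "a \<ge> 1" "x * a \<ge> 1" using assms by (auto simp: a_def max_def field_simps)
  have geq: "kappa_log_plus x = (ln (x * a) + 1) / a"
    using assms by (auto simp: kappa_log_plus_def a_def max_def field_simps)
  \<comment> \<open>An antiderivative that tends to 0 at infinity, so the integral over
    \<open>{a..}\<close> is \<open>- F a\<close>.\<close>
  define F where "F = (\<lambda>s. - (ln (x * s) + 1) / s)"
  have deriv: "((\<lambda>s. ln (x * s) / s\<^sup>2) has_integral (F y - F a)) {a..y}" if "y \<ge> a" for y
    unfolding F_def using a assms
    by (intro fundamental_theorem_of_calculus that)
       (auto intro!: derivative_eq_intros
             simp flip: has_real_derivative_iff_has_vector_derivative simp: field_simps power2_eq_square)
  have "((\<lambda>s. ln (x * s) / s\<^sup>2) has_integral (- F a)) {a..}"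
  proof (rule has_integral_to_inf)
    show "(\<lambda>s. ln (x * s) / s\<^sup>2) integrable_on {a..y}" for y
      using deriv[of y] by (cases "y \<ge> a") (auto simp: integrable_on_def)
    have "(F \<longlongrightarrow> 0) at_top"
      unfolding F_def using assms by real_asymp
    then have "((\<lambda>y. F y - F a) \<longlongrightarrow> - F a) at_top"
      using tendsto_diff[of F 0 at_top "\<lambda>_. F a"] by simp
    moreover have "\<forall>\<^sub>F y in at_top. F y - F a = integral {a..y} (\<lambda>s. ln (x * s) / s\<^sup>2)"
      by (rule eventually_mono[OF eventually_ge_at_top[of a]])
         (rule integral_unique[OF deriv, symmetric])
    ultimately show "((\<lambda>y. integral {a..y} (\<lambda>s. ln (x * s) / s\<^sup>2)) \<longlongrightarrow> - F a) at_top"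
      by (rule Lim_transform_eventually)
    fix s assume "s \<ge> a"
    then have "x * s \<ge> 1" using a assms
      by (meson dual_order.trans mult_le_cancel_left_pos)
    then show "ln (x * s) / s\<^sup>2 \<ge> 0" by simp
  qed
  then have "((\<lambda>s. log_plus (x * s) / s\<^sup>2) has_integral (- F a)) {a..}"
  proof (rule has_integral_eq[rotated])
    fix s assume "s \<in> {a..}"
    then have "x * s \<ge> 1" using a assms
      by (meson atLeast_iff dual_order.trans mult_le_cancel_left_pos)
    then show "ln (x * s) / s\<^sup>2 = log_plus (x * s) / s\<^sup>2" by (simp add: log_plus_eq_ln)
  qed
  then have "((\<lambda>s. if s \<in> {a..} then log_plus (x * s) / s\<^sup>2 else 0) has_integral (- F a)) {1..}"
    using a by (intro iffD2[OF has_integral_restrict]) auto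
  then have "((\<lambda>s. log_plus (x * s) / s\<^sup>2) has_integral (- F a)) {1..}"
  proof (rule has_integral_eq[rotated])
    fix s :: real assume s: "s \<in> {1..}"
    show "(if s \<in> {a..} then log_plus (x * s) / s\<^sup>2 else 0) = log_plus (x * s) / s\<^sup>2"
    proof (cases "s \<ge> a")
      case False
      then have "s < 1 / x" using s by (auto simp: a_def max_def split: if_splits)
      then have "x * s \<le> 1" using assms by (simp add: field_simps)
      then show ?thesis using False s assms by (simp add: log_plus_eq_0)
    qed simp
  qed
  moreover have "- F a = kappa_log_plus x" 
    unfolding F_def geq minus_divide_left by simp
  ultimately show ?thesis by simp
qed

section \<open>Log-convex sequences and their quotients\<close>

locale log_convex_sequence =
  fixes M :: "nat \<Rightarrow> real"
  assumes M_0 [simp]: "M 0 = 1"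
    and M_mono: "M k \<le> M (Suc k)"
    and M_log_convex: "(M (Suc k))\<^sup>2 \<le> M k * M (Suc (Suc k))"
begin

(* Shifted by one: quot k is mu_{k+1}. *)
definition quot :: "nat \<Rightarrow> real" where
  "quot k = M (Suc k) / M k"

lemma M_ge_1: "1 \<le> M k"
proof (induction k)
  case (Suc k)
  then show ?case using M_mono[of k] by linarith
qed simp

lemma M_pos [simp]: "0 < M k"
  using M_ge_1[of k] by linarith

lemma M_neq_0 [simp]: "M k \<noteq> 0"
  using M_pos[of k] by linarith

lemma quot_ge_1: "1 \<le> quot k"
  using M_mono[of k] by (simp add: quot_def)

lemma quot_pos [simp]: "0 < quot k"
  by (simp add: quot_def)

lemma quot_neq_0 [simp]: "quot k \<noteq> 0"
  using quot_pos[of k] by linarith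

lemma quot_mono: "i \<le> j \<Longrightarrow> quot i \<le> quot j"
proof (rule lift_Suc_mono_le[of quot])
  show "quot k \<le> quot (Suc k)" for k
    using M_log_convex[of k] M_pos[of k] M_pos[of "Suc k"]
    by (simp add: quot_def divide_simps power2_eq_square mult.commute)
qed

lemma M_eq_prod: "M k = (\<Prod>l<k. quot l)"
  by (induction k) (auto simp: quot_def)

lemma ln_power_div_M:
  assumes "0 < t"
  shows "ln (t ^ k / M k) = (\<Sum>l<k. ln (t / quot l))"
proof -
  have "t ^ k / M k = (\<Prod>l<k. t / quot l)"
    by (simp add: M_eq_prod prod_dividef)
  moreover have "ln (\<Prod>l<k. t / quot l) = (\<Sum>l<k. ln (t / quot l))"
    using assms by (intro ln_prod) auto
  ultimately show ?thesis by simp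
qed

text \<open>Since the quotients increase, the nonzero positive parts form an initial segment, and
  their sum is \<open>ln (t ^ k / M k)\<close> for a suitable \<open>k\<close>. Summability is not
  yet available here: this bound is what later proves it for the weight matrix.\<close>

lemma sum_log_plus_le:
  assumes "0 < t" and c: "\<And>k. ln (t ^ k / M k) \<le> c"
  shows "(\<Sum>l<N. log_plus (t / quot l)) \<le> c"
proof (induction N)
  case 0
  then show ?case using c[of 0] by simp
next
  case (Suc N)
  show ?case
  proof (cases "quot N \<le> t")
    case True
    then have "quot l \<le> t" if "l < Suc N" for l
      using quot_mono[of l N] that by linarith
    then have "(\<Sum>l<Suc N. log_plus (t / quot l)) = (\<Sum>l<Suc N. ln (t / quot l))"
      by (intro sum.cong refl log_plus_eq_ln) (auto simp: divide_simps)
    then show ?thesis using c[of "Suc N"] ln_power_div_M[OF assms(1), of "Suc N"] by simp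
  next
    case False
    then have "log_plus (t / quot N) = 0"
      using assms by (intro log_plus_eq_0) (auto simp: divide_simps)
    with Suc show ?thesis by simp
  qed
qed

end

section \<open>Associated function when the reciprocal quotients are summable\<close>

locale weight_sequence = log_convex_sequence +
  assumes summable_quot: "summable (\<lambda>k. M k / M (Suc k))"
begin

lemma summable_inverse_quot: "summable (\<lambda>k. 1 / quot k)"
  using summable_quot by (simp add: quot_def)

text \<open>Makes the \<open>LEAST\<close> in \<open>count\<close> meaningful: quotients bounded by
  \<open>t\<close> would keep their reciprocals above \<open>1 / t\<close>, against the convergence
  of the series.\<close>

lemma quot_unbounded: "\<exists>k. t < quot k"
proof (rule ccontr)
  assume "\<not> ?thesis"
  then have le: "quot k \<le> t" for k by (simp add: not_less)
  then have "t > 0" using quot_pos[of 0] le[of 0] by linarith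
  have "(\<lambda>k. 1 / quot k) \<longlonglongrightarrow> 0" by (rule summable_LIMSEQ_zero[OF summable_inverse_quot])
  then have "\<forall>\<^sub>F k in sequentially. 1 / quot k < 1 / t"
    using \<open>t > 0\<close> by (intro order_tendstoD(2)) auto
  then obtain k where "1 / quot k < 1 / t"
    using eventually_happens'[OF sequentially_bot] by blast
  moreover have "1 / t \<le> 1 / quot k"
    using le[of k] by (intro divide_left_mono) (use \<open>t > 0\<close> in auto)
  ultimately show False by linarith
qed

text \<open>As the quotients increase, this least index is the number of quotients that are at most
  \<open>t\<close>.\<close>

definition count :: "real \<Rightarrow> nat" where
  "count t = (LEAST k. t < quot k)"

lemma quot_gt: "count t \<le> l \<Longrightarrow> t < quot l"
proof -
  have "t < quot (count t)"
    unfolding count_def by (rule LeastI_ex[OF quot_unbounded])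
  then show "count t \<le> l \<Longrightarrow> t < quot l"
    using quot_mono[of "count t" l] by linarith
qed

lemma quot_le: "l < count t \<Longrightarrow> quot l \<le> t"
  unfolding count_def using not_less_Least[of l "\<lambda>k. t < quot k"] by simp

definition omega :: "real \<Rightarrow> real" where
  "omega t = (\<Sum>l<count t. log_plus (t / quot l))"

lemma log_plus_quot_eq_0: "0 \<le> t \<Longrightarrow> count t \<le> l \<Longrightarrow> log_plus (t / quot l) = 0"
  using quot_gt[of t l] by (intro log_plus_eq_0) (auto simp: divide_simps)

lemma omega_eq_sum_ge:
  assumes "0 \<le> t" "count t \<le> N"
  shows "(\<Sum>l<N. log_plus (t / quot l)) = omega t"
  unfolding omega_def using assms
  by (intro sum.mono_neutral_right) (auto simp: log_plus_quot_eq_0)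

lemma sum_log_plus_le_omega:
  assumes "0 \<le> t"
  shows "(\<Sum>l<N. log_plus (t / quot l)) \<le> omega t"
proof -
  have "(\<Sum>l<N. log_plus (t / quot l)) \<le> (\<Sum>l<max N (count t). log_plus (t / quot l))"
    by (intro sum_mono2) auto
  then show ?thesis using assms by (simp add: omega_eq_sum_ge)
qed

lemma omega_nonneg: "0 \<le> omega t"
  by (simp add: omega_def sum_nonneg)

lemma omega_eq_sum_ln: "omega t = (\<Sum>l<count t. ln (t / quot l))"
  unfolding omega_def
  by (intro sum.cong refl log_plus_eq_ln) (use quot_le in \<open>auto simp: divide_simps\<close>)

lemma ln_power_div_M_le_omega:
  assumes "0 < t"
  shows "ln (t ^ k / M k) \<le> omega t"
proof -
  have "ln (t ^ k / M k) \<le> (\<Sum>l<k. log_plus (t / quot l))"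
    unfolding ln_power_div_M[OF assms] by (intro sum_mono ln_le_log_plus)
  also have "\<dots> \<le> omega t" using assms by (intro sum_log_plus_le_omega) auto
  finally show ?thesis .
qed

lemma power_div_M_le: "0 < t \<Longrightarrow> t ^ k / M k \<le> exp (omega t)"
  using ln_power_div_M_le_omega[of t k] by (subst ln_le_cancel_iff[symmetric]) simp_all

lemma ln_power_div_M_count:
  "0 < t \<Longrightarrow> ln (t ^ count t / M (count t)) = omega t"
  by (simp add: ln_power_div_M omega_eq_sum_ln)

text \<open>The supremum is a maximum, attained at \<open>count t\<close>: the factors
  \<open>t / quot l\<close> are at least 1 before that index and below 1 from it on.\<close>

lemma omega_seq_eq_omega:
  assumes "0 < t"
  shows "omega_seq M t = omega t"
proof -
  have "t ^ count t / M (count t) = exp (omega t)"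
    using ln_power_div_M_count[OF assms] assms
    by (metis M_pos divide_pos_pos exp_ln zero_less_power)
  then have "(SUP k. t ^ k * M 0 / M k) = exp (omega t)"
    using power_div_M_le[OF assms]
    by (intro cSup_eq_maximum) (auto intro!: rangeI image_eqI[of _ _ "count t"])
  then show ?thesis by (simp add: omega_seq_def)
qed

(* tail k is the sum of 1/mu_l over l > k, again shifted against the indexing of Lseq. *)
definition tail :: "nat \<Rightarrow> real" where
  "tail k = (\<Sum>l. 1 / quot (l + k))"

lemma summable_tail: "summable (\<lambda>l. 1 / quot (l + k))"
  by (rule summable_ignore_initial_segment[OF summable_inverse_quot])

lemma tail_pos: "0 < tail k"
  unfolding tail_def by (rule suminf_pos[OF summable_tail]) simp

lemma tail_split: "tail k = (\<Sum>l<m. 1 / quot (l + k)) + tail (k + m)"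
  unfolding tail_def
  using suminf_split_initial_segment[OF summable_tail, of k m] by (simp add: ac_simps)

lemma tail_antimono: "i \<le> j \<Longrightarrow> tail j \<le> tail i"
  using tail_split[of i "j - i"] by (simp add: sum_nonneg less_imp_le)

lemma tail_Suc_ge: "1 / quot k \<le> tail k"
  using tail_split[of k 1] tail_pos[of "k + 1"] by simp

section \<open>The transform \<open>kappa\<close> of the associated function\<close>

definition kap :: "real \<Rightarrow> real" where
  "kap t = real (count t) + omega t + t * tail (count t)"

text \<open>Monotone convergence over the partial sums: a quotient at most \<open>t\<close>
  contributes \<open>1 + ln (t / quot l)\<close>, a larger one \<open>t / quot l\<close>.\<close>

lemma has_integral_kap:
  assumes "0 < t"
  shows "((\<lambda>s. omega (t * s) / s\<^sup>2) has_integral kap t) {1..}"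
proof (rule has_integral_monotone_convergence_increasing)
  let ?f = "\<lambda>N s. \<Sum>l<N. log_plus (t / quot l * s) / s\<^sup>2"
  show "(?f N has_integral (\<Sum>l<N. kappa_log_plus (t / quot l))) {1..}" for N
    using assms by (intro has_integral_sum has_integral_log_plus) auto
  show "?f N s \<le> ?f (Suc N) s" for N s by simp
  show "(\<lambda>N. ?f N s) \<longlonglongrightarrow> omega (t * s) / s\<^sup>2" if "s \<in> {1..}" for s
  proof (rule tendsto_eventually)
    show "\<forall>\<^sub>F N in sequentially. ?f N s = omega (t * s) / s\<^sup>2"
      using eventually_ge_at_top[of "count (t * s)"]
    proof eventually_elim
      case (elim N)
      have "?f N s = (\<Sum>l<N. log_plus (t * s / quot l)) / s\<^sup>2"
        by (simp add: sum_divide_distrib)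
      then show ?case using elim that assms by (simp add: omega_eq_sum_ge)
    qed
  qed
  let ?n = "count t"
  have init: "(\<Sum>l<?n. kappa_log_plus (t / quot l)) = real ?n + omega t"
  proof -
    have "(\<Sum>l<?n. kappa_log_plus (t / quot l)) = (\<Sum>l<?n. 1 + ln (t / quot l))"
      by (intro sum.cong refl) (use quot_le in \<open>auto simp: kappa_log_plus_def divide_simps\<close>)
    then show ?thesis by (simp add: sum.distrib omega_eq_sum_ln)
  qed
  have shifted: "kappa_log_plus (t / quot (l + ?n)) = t * (1 / quot (l + ?n))" for l
    using quot_gt[of t "l + ?n"] by (simp add: kappa_log_plus_def divide_simps)
  have "(\<lambda>l. kappa_log_plus (t / quot (l + ?n))) sums (t * tail ?n)"
    unfolding shifted tail_def by (intro sums_mult summable_sums summable_tail)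
  then have "(\<lambda>l. kappa_log_plus (t / quot l)) sums kap t"
    using sums_iff_shift[of "\<lambda>l. kappa_log_plus (t / quot l)" ?n "t * tail ?n"] init
    by (simp add: kap_def add_ac)
  then show "(\<lambda>N. \<Sum>l<N. kappa_log_plus (t / quot l)) \<longlonglongrightarrow> kap t"
    by (simp add: sums_def)
qed

text \<open>The extra summand \<open>ln (1 + t\<^sup>2)\<close> is nonnegative and costs at most one
  more \<open>omega\<close> plus a constant, because \<open>t\<^sup>2 / M 2\<close> is one of the
  terms under the supremum.\<close>

lemma kappa_omega_tilde_bounds:
  assumes "1 \<le> t"
  shows "kap t \<le> kappa (omega_tilde M) t"
    and "kappa (omega_tilde M) t \<le> 2 * kap t + (ln 2 + ln (M 2))"
proof -
  \<comment> \<open>For \<open>u \<ge> 1\<close>, \<open>1 + u\<^sup>2\<close> is at most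
    \<open>2 * M 2\<close> times \<open>u\<^sup>2 / M 2\<close>. Integration keeps the constant, as
    \<open>1 / s\<^sup>2\<close> has integral 1 over \<open>{1..}\<close>.\<close>
  define c where "c = ln 2 + ln (M 2)"
  let ?h = "\<lambda>s. ln (1 + (t * s)\<^sup>2) / s\<^sup>2"
  let ?w = "\<lambda>s. omega (t * s) / s\<^sup>2"
  have w: "(?w has_integral kap t) {1..}"
    using assms by (intro has_integral_kap) simp
  have "((\<lambda>s::real. 1 / s\<^sup>2) has_integral 1) {1..}"
    using has_integral_inverse_power_to_inf[of 2 1] by simp
  then have "((\<lambda>s. c * (1 / s\<^sup>2)) has_integral c * 1) {1..}"
    by (rule has_integral_mult_right)
  then have up: "((\<lambda>s. ?w s + c / s\<^sup>2) has_integral kap t + c) {1..}"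
    using has_integral_add[OF w] by simp
  have h_nonneg: "0 \<le> ?h s" for s by simp
  have h_le: "?h s \<le> ?w s + c / s\<^sup>2" if "1 \<le> s" for s
  proof -
    have u: "1 \<le> t * s" using mult_mono[of 1 t 1 s] assms that by simp
    then have "1 \<le> (t * s)\<^sup>2" by (rule one_le_power)
    then have "ln (1 + (t * s)\<^sup>2) \<le> ln (2 * (t * s)\<^sup>2)" by (intro ln_mono) linarith+
    also have "\<dots> = ln 2 + 2 * ln (t * s)"
      using u by (subst ln_mult_pos) (auto simp: ln_realpow simp del: power_mult_distrib)
    also have "2 * ln (t * s) = ln ((t * s) ^ 2 / M 2) + ln (M 2)"
      using u by (subst ln_div) (auto simp: ln_realpow)
    also have "ln ((t * s) ^ 2 / M 2) \<le> omega (t * s)"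
      using u by (intro ln_power_div_M_le_omega) simp
    finally have "ln (1 + (t * s)\<^sup>2) \<le> omega (t * s) + c" by (simp add: c_def)
    from divide_right_mono[OF this, of "s\<^sup>2"] show ?thesis by (simp add: add_divide_distrib)
  qed
  have "?h integrable_on {1..}"
  proof (rule measurable_bounded_by_integrable_imp_integrable)
    have "1 + (t * s)\<^sup>2 \<noteq> 0" for s by (smt (verit) zero_le_power2)
    then have "continuous_on {1..} ?h"
      by (intro continuous_intros) auto
    then show "?h \<in> borel_measurable (lebesgue_on {1..})"
      by (rule continuous_imp_measurable_on_sets_lebesgue) simp
    show "(\<lambda>s. ?w s + c / s\<^sup>2) integrable_on {1..}" using up by (rule has_integral_integrable)
    show "norm (?h s) \<le> ?w s + c / s\<^sup>2" if "s \<in> {1..}" for s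
      using h_le[of s] h_nonneg[of s] that by simp
  qed simp
  then obtain i where i: "(?h has_integral i) {1..}" by (auto simp: integrable_on_def)
  have "0 \<le> i" using has_integral_nonneg[OF i] h_nonneg by simp
  have "i \<le> kap t + c" using has_integral_le[OF i up] h_le by simp
  have "((\<lambda>s. omega_tilde M (t * s) / s\<^sup>2) has_integral kap t + i) {1..}"
  proof (rule has_integral_eq[OF _ has_integral_add[OF w i]])
    fix s :: real assume "s \<in> {1..}"
    then have "0 < t * s" using assms by simp
    then show "?w s + ?h s = omega_tilde M (t * s) / s\<^sup>2"
      by (simp add: omega_tilde_def omega_seq_eq_omega add_divide_distrib)
  qed
  then have "kappa (omega_tilde M) t = kap t + i"
    unfolding kappa_def by (rule integral_unique)
  with \<open>0 \<le> i\<close> \<open>i \<le> kap t + c\<close> show "kap t \<le> kappa (omega_tilde M) t"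
    and "kappa (omega_tilde M) t \<le> 2 * kap t + (ln 2 + ln (M 2))"
    by (simp_all add: c_def)
qed

section \<open>The sequence \<open>Lseq M\<close>\<close>

lemma sum_inverse_mu: "0 < k \<Longrightarrow> (\<Sum>l. 1 / mu M (l + k)) = tail (k - 1)"
  \<comment> \<open>\<open>mu M (l + k)\<close> is \<open>quot (l + k - 1)\<close>, whence the index
    \<open>k - 1\<close>.\<close>
  by (cases k) (simp_all add: tail_def mu_def quot_def)

lemma Lseq_0 [simp]: "Lseq M 0 = 1"
  by (simp add: Lseq_def)

lemma Lseq_attained:
  assumes "0 < k"
  obtains j where "j < k" "Lseq M k = (real k / tail (k - 1)) ^ (k - j) * M j"
proof -
  let ?S = "(\<lambda>j. (real k / tail (k - 1)) ^ (k - j) * M j) ` {0..<k}"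
  have "Lseq M k = Min ?S" using assms by (simp add: Lseq_def sum_inverse_mu)
  moreover have "Min ?S \<in> ?S" using assms by (intro Min_in) auto
  ultimately show ?thesis using that by auto
qed

lemma Lseq_le:
  assumes "j < k"
  shows "Lseq M k \<le> (real k / tail (k - 1)) ^ (k - j) * M j"
proof -
  let ?S = "(\<lambda>j. (real k / tail (k - 1)) ^ (k - j) * M j) ` {0..<k}"
  have "Lseq M k = Min ?S" using assms by (simp add: Lseq_def sum_inverse_mu)
  moreover have "Min ?S \<le> (real k / tail (k - 1)) ^ (k - j) * M j"
    using assms by (intro Min_le) auto
  ultimately show ?thesis by simp
qed

lemma Lseq_pos [simp]: "0 < Lseq M k"
proof (cases "k = 0")
  case False
  then obtain j where "Lseq M k = (real k / tail (k - 1)) ^ (k - j) * M j"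
    using Lseq_attained by auto
  with False show ?thesis by (simp add: tail_pos)
qed simp

text \<open>Separates a candidate of the minimum into a power governed by the tail and the
  \<open>j\<close>-th term of the associated function of \<open>M\<close>.\<close>

lemma power_div_Lseq_term:
  assumes "j < k"
  shows "t ^ k / ((real k / tail (k - 1)) ^ (k - j) * M j)
    = (t * tail (k - 1) / real k) ^ (k - j) * (t ^ j / M j)"
proof -
  have "t ^ k = t ^ (k - j) * t ^ j" using assms by (simp flip: power_add)
  then show ?thesis using assms tail_pos[of "k - 1"]
    by (simp add: power_divide power_mult_distrib field_simps)
qed

section \<open>Upper bound for the associated function of \<open>Lseq M\<close>\<close>

text \<open>The bound is uniform in \<open>k\<close>. The tool is \<open>ln y \<le> y\<close>,
  applied to the dominant part of the tail: the quotients up to \<open>t\<close> or those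
  beyond.\<close>

lemma tail_power_le:
  assumes "0 < t" "0 < k"
  shows "real k * ln (t * tail (k - 1) / real k) \<le> 2 * real (count t) + omega t + 2 * (t * tail (count t))"
proof -
  define n b x where "n = count t" and "b = t * tail n" and "x = t * tail (k - 1) / real k"
  have "0 < b" using assms by (simp add: b_def tail_pos)
  have "0 < x" using assms by (simp add: x_def tail_pos)
  have k_ln_le: "real k * ln y \<le> real k * y" if "0 < y" for y
    using ln_le_minus_one[OF that] by (intro mult_left_mono) auto
  have "real k * ln x \<le> 2 * real n + omega t + 2 * b"
  proof (cases "n < k")
    \<comment> \<open>The tail starts beyond all quotients that are at most \<open>t\<close>, so
      \<open>real k * x\<close> is at most \<open>b\<close>.\<close>
    case True
    then have "tail (k - 1) \<le> tail n" by (intro tail_antimono) linarith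
    then have "real k * x \<le> b"
      using assms by (simp add: x_def b_def)
    with k_ln_le[OF \<open>0 < x\<close>] \<open>0 < b\<close> omega_nonneg[of t] show ?thesis by linarith
  next
    case False
    \<comment> \<open>The quotients with indices from \<open>k - 1\<close> to \<open>n - 1\<close>
      are at least \<open>q\<close>, and there are at most \<open>n\<close> of them. Their share of
      the tail, multiplied by \<open>t\<close>, is at most \<open>a\<close>; the rest gives
      \<open>b\<close>.\<close>
    define q where "q = quot (k - 1)"
    have q: "0 < q" "q \<le> t" using False assms by (auto simp: q_def n_def intro: quot_le)
    define a where "a = real n * (t / q)"
    have "(\<Sum>l<n - (k - 1). 1 / quot (l + (k - 1))) \<le> (\<Sum>l<n - (k - 1). 1 / q)"
      unfolding q_def by (intro sum_mono divide_left_mono quot_mono) auto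
    also have "\<dots> \<le> real n * (1 / q)"
      using q by (simp add: divide_right_mono)
    finally have "tail (k - 1) \<le> real n * (1 / q) + tail n"
      using tail_split[of "k - 1" "n - (k - 1)"] False assms by simp
    then have "t * tail (k - 1) \<le> t * (real n * (1 / q) + tail n)"
      using assms by (intro mult_left_mono) auto
    then have x_le: "x \<le> (a + b) / real k"
      unfolding x_def by (intro divide_right_mono) (auto simp: a_def b_def algebra_simps)
    show ?thesis
    proof (cases "b \<le> a")
      case True
      then have "(a + b) / real k \<le> 2 * a / real k" by (intro divide_right_mono) auto
      \<comment> \<open>After multiplication by \<open>k\<close>, the logarithm of
        \<open>2 * n / k\<close> costs at most \<open>2 * n\<close>; replacing \<open>q\<close> by
        the smaller \<open>quot l\<close> turns \<open>k * ln (t / q)\<close> into a term of the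
        associated function.\<close>
      with x_le have "x \<le> (2 * real n / real k) * (t / q)" by (simp add: a_def mult_ac)
      then have "ln x \<le> ln ((2 * real n / real k) * (t / q))"
        using \<open>0 < x\<close> by (intro ln_mono) auto
      also have "\<dots> = ln (2 * real n / real k) + ln (t / q)"
        using False assms q by (intro ln_mult_pos) auto
      finally have "real k * ln x \<le> real k * ln (2 * real n / real k) + real k * ln (t / q)"
        using mult_left_mono[of "ln x" "ln (2 * real n / real k) + ln (t / q)" "real k"]
        by (simp add: distrib_left)
      also have "real k * ln (2 * real n / real k) \<le> real k * (2 * real n / real k)"
        using False assms by (intro k_ln_le) auto
      also have "\<dots> = 2 * real n" using assms by simp
      also have "real k * ln (t / q) = (\<Sum>l<k. ln (t / q))" by simp
      also have "\<dots> \<le> (\<Sum>l<k. ln (t / quot l))"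
        using assms unfolding q_def by (intro sum_mono ln_mono divide_left_mono quot_mono) auto
      also have "\<dots> \<le> omega t"
        using ln_power_div_M_le_omega[OF assms(1), of k] ln_power_div_M[OF assms(1), of k] by simp
      finally show ?thesis using \<open>0 < b\<close> by linarith
    next
      case False
      then have "real k * x \<le> 2 * b"
        using x_le assms by (simp add: field_simps)
      with k_ln_le[OF \<open>0 < x\<close>] omega_nonneg[of t] show ?thesis by linarith
    qed
  qed
  then show ?thesis by (simp add: x_def b_def n_def)
qed

text \<open>For the \<open>j\<close> attaining the minimum, the power of the tail costs
  \<open>c\<close> and the remaining term \<open>omega t\<close>; together this is
  \<open>2 * kap t\<close>.\<close>

lemma power_div_Lseq_le:
  assumes "0 < t"
  shows "t ^ k / Lseq M k \<le> exp (2 * kap t)"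
proof (cases "k = 0")
  case True
  have "0 \<le> kap t" using assms omega_nonneg[of t] tail_pos[of "count t"] by (simp add: kap_def)
  with True show ?thesis by simp
next
  case False
  then obtain j where j: "j < k" "Lseq M k = (real k / tail (k - 1)) ^ (k - j) * M j"
    using Lseq_attained by auto
  define x where "x = t * tail (k - 1) / real k"
  define c where "c = 2 * real (count t) + omega t + 2 * (t * tail (count t))"
  have "0 < x" using assms False by (simp add: x_def tail_pos)
  have "0 \<le> c" using assms omega_nonneg[of t] tail_pos[of "count t"] by (simp add: c_def)
  \<comment> \<open>\<open>tail_power_le\<close> concerns the exponent \<open>k\<close>: a base
    above 1 allows raising \<open>k - j\<close> to \<open>k\<close>, and a base at most 1 is covered
    by \<open>0 \<le> c\<close>.\<close>
  have "x ^ (k - j) \<le> exp c"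
  proof (cases "x \<le> 1")
    case True
    then have "x ^ (k - j) \<le> 1" using \<open>0 < x\<close> by (intro power_le_one) auto
    also have "1 \<le> exp c" using \<open>0 \<le> c\<close> by simp
    finally show ?thesis .
  next
    case False
    then have "x ^ (k - j) \<le> x ^ k" by (intro power_increasing) auto
    also have "x ^ k = exp (real k * ln x)" using \<open>0 < x\<close> by (simp add: exp_of_nat_mult)
    also have "\<dots> \<le> exp c" using tail_power_le[OF assms, of k] \<open>k \<noteq> 0\<close>
      by (simp add: x_def c_def)
    finally show ?thesis .
  qed
  then have "x ^ (k - j) * (t ^ j / M j) \<le> exp c * exp (omega t)"
    using assms by (intro mult_mono power_div_M_le) (auto simp: less_imp_le)
  also have "\<dots> = exp (2 * kap t)" by (simp add: c_def kap_def flip: exp_add)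
  finally show ?thesis unfolding j(2) power_div_Lseq_term[OF j(1)] by (simp add: x_def)
qed

text \<open>A real supremum is informative only for a bounded set. Passing to \<open>max t 1\<close>
  covers \<open>t = 0\<close>.\<close>

lemma bdd_above_power_div_Lseq:
  assumes "0 \<le> t"
  shows "bdd_above (range (\<lambda>k. t ^ k * Lseq M 0 / Lseq M k))"
proof (rule bdd_aboveI2)
  fix k
  have "t ^ k / Lseq M k \<le> max t 1 ^ k / Lseq M k"
    using assms by (intro divide_right_mono power_mono) (auto simp: less_imp_le)
  also have "\<dots> \<le> exp (2 * kap (max t 1))" by (intro power_div_Lseq_le) simp
  finally show "t ^ k * Lseq M 0 / Lseq M k \<le> exp (2 * kap (max t 1))" by simp
qed

lemma power_div_Lseq_le_exp_omega_seq:
  assumes "0 \<le> t"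
  shows "t ^ k / Lseq M k \<le> exp (omega_seq (Lseq M) t)"
proof -
  let ?s = "SUP k. t ^ k * Lseq M 0 / Lseq M k"
  have le: "t ^ k / Lseq M k \<le> ?s" for k
    using cSUP_upper[OF UNIV_I bdd_above_power_div_Lseq[OF assms], of k] by simp
  have "0 < ?s" using le[of 0] by simp
  with le[of k] show ?thesis by (simp add: omega_seq_def)
qed

lemma omega_seq_Lseq_nonneg: "0 \<le> t \<Longrightarrow> 0 \<le> omega_seq (Lseq M) t"
  using power_div_Lseq_le_exp_omega_seq[of t 0] by simp

lemma omega_seq_Lseq_le:
  assumes "0 < t"
  shows "omega_seq (Lseq M) t \<le> 2 * kap t"
proof -
  let ?s = "SUP k. t ^ k * Lseq M 0 / Lseq M k"
  have "?s \<le> exp (2 * kap t)"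
    using power_div_Lseq_le[OF assms] by (intro cSUP_least) auto
  moreover have "1 \<le> ?s"
    using cSUP_upper[OF UNIV_I bdd_above_power_div_Lseq, of t 0] assms by simp
  ultimately have "ln ?s \<le> ln (exp (2 * kap t))" by (intro ln_mono) linarith+
  then show ?thesis by (simp add: omega_seq_def)
qed

section \<open>Lower bound for the associated function of \<open>Lseq M\<close>\<close>

text \<open>Since \<open>Lseq M k\<close> is a minimum, every pair \<open>j < k\<close> gives a
  lower bound; what remains is to choose good pairs.\<close>

lemma omega_seq_Lseq_ge:
  assumes "0 < t" "j < k"
  shows "real (k - j) * ln (t * tail (k - 1) / real k) + ln (t ^ j / M j) \<le> omega_seq (Lseq M) t"
proof -
  let ?x = "t * tail (k - 1) / real k"
  have x: "0 < ?x" using assms by (simp add: tail_pos)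
  have "?x ^ (k - j) * (t ^ j / M j) = t ^ k / ((real k / tail (k - 1)) ^ (k - j) * M j)"
    using power_div_Lseq_term[OF assms(2)] by simp
  also have "\<dots> \<le> t ^ k / Lseq M k"
    using assms Lseq_le by (intro divide_left_mono mult_pos_pos) (auto simp: tail_pos)
  also have "\<dots> \<le> exp (omega_seq (Lseq M) t)"
    using assms by (intro power_div_Lseq_le_exp_omega_seq) simp
  finally have "ln (?x ^ (k - j) * (t ^ j / M j)) \<le> ln (exp (omega_seq (Lseq M) t))"
    using x assms by (intro ln_mono) auto
  moreover have "ln (?x ^ (k - j) * (t ^ j / M j)) = ln (?x ^ (k - j)) + ln (t ^ j / M j)"
    using x assms by (intro ln_mult_pos) auto
  moreover have "ln (?x ^ (k - j)) = real (k - j) * ln ?x" using x by (intro ln_realpow)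
  ultimately show ?thesis by simp
qed

text \<open>Reason for the dilation by \<open>exp 1\<close>: the gain \<open>j\<close> pays for
  logarithmic losses.\<close>

lemma ln_exp_power_div_M:
  assumes "0 < t"
  shows "ln ((exp 1 * t) ^ j / M j) = real j + ln (t ^ j / M j)"
proof -
  have "(exp 1 * t) ^ j / M j = exp 1 ^ j * (t ^ j / M j)" by (simp add: power_mult_distrib)
  also have "ln \<dots> = ln (exp 1 ^ j) + ln (t ^ j / M j)"
    using assms by (intro ln_mult_pos) auto
  also have "ln (exp (1::real) ^ j) = real j" by (simp flip: exp_of_nat_mult)
  finally show ?thesis .
qed

text \<open>The pair is \<open>j = n - 1\<close>, \<open>k = n\<close> with
  \<open>n = count t\<close>. The base is at least \<open>exp 1 / n\<close>, and the loss
  \<open>ln n\<close> is paid by half of the gain \<open>n\<close> from the dilation. Omitting the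
  last quotient loses at most \<open>ln t\<close>, which is at most half of
  \<open>omega t + ln (M 2)\<close>.\<close>

lemma count_plus_omega_le:
  assumes "1 \<le> t"
  shows "real (count t) + omega t \<le> 2 * omega_seq (Lseq M) (exp 1 * t) + ln (M 2)"
proof (cases "count t")
  case 0
  then have "omega t = 0" by (simp add: omega_def)
  with 0 omega_seq_Lseq_nonneg[of "exp 1 * t"] M_ge_1[of 2] assms show ?thesis by simp
next
  case (Suc i)
  let ?n = "real (Suc i)"
  have qi: "quot i \<le> t" using Suc by (intro quot_le) simp
  have "t * (1 / quot i) \<le> t * tail i"
    using tail_Suc_ge[of i] assms by (intro mult_left_mono) auto
  moreover have "1 \<le> t * (1 / quot i)" using qi by simp
  ultimately have "1 \<le> t * tail i" by linarith
  then have "exp 1 / ?n \<le> exp 1 * t * tail i / ?n" by (intro divide_right_mono) auto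
  then have "ln (exp 1 / ?n) \<le> ln (exp 1 * t * tail i / ?n)" by (intro ln_mono) auto
  moreover have "ln (exp 1 / ?n) = 1 - ln ?n" by (subst ln_div) auto
  \<comment> \<open>From \<open>ln (n / 2) \<le> n / 2 - 1\<close> and
    \<open>ln 2 < 1\<close>.\<close>
  moreover have "ln ?n \<le> ?n / 2"
    using ln_le_minus_one[of "?n / 2"] ln_div[of ?n 2] ln_2_less_1 by simp
  moreover have "omega t \<le> ln (t ^ i / M i) + ln t"
  proof -
    have "omega t = ln (t ^ i / M i) + ln (t / quot i)"
      using assms Suc by (simp add: omega_eq_sum_ln ln_power_div_M)
    moreover have "ln (t / quot i) \<le> ln t"
      using assms quot_ge_1[of i] by (intro ln_mono) (auto simp: divide_simps)
    ultimately show ?thesis by simp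
  qed
  moreover have "2 * ln t - ln (M 2) \<le> omega t"
    using ln_power_div_M_le_omega[of t 2] assms by (simp add: ln_div ln_realpow)
  moreover have "ln (exp 1 * t * tail i / ?n) + (real i + ln (t ^ i / M i))
      \<le> omega_seq (Lseq M) (exp 1 * t)"
    using omega_seq_Lseq_ge[of "exp 1 * t" i "Suc i"] assms
    by (simp add: ln_exp_power_div_M)
  ultimately show ?thesis unfolding Suc by (simp add: field_simps)
qed

text \<open>The pair is \<open>j = n\<close>, \<open>k = n + m\<close> with \<open>m\<close> the
  rounded \<open>b / 8\<close>. Starting the tail at \<open>n + m - 1\<close> drops
  \<open>m - 1\<close> quotients above \<open>t\<close>, each worth less than 1 in \<open>b\<close>.
  What is left is at least \<open>n + m\<close>, so the logarithm after dilation is at least 1, and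
  it is counted \<open>m\<close> times.\<close>

lemma tail_le_omega_seq_Lseq:
  assumes "1 \<le> t" and b: "8 \<le> t * tail (count t)" "8 * real (count t) \<le> t * tail (count t)"
  shows "t * tail (count t) \<le> 8 * omega_seq (Lseq M) (exp 1 * t)"
proof -
  define n b m where "n = count t" and "b = t * tail n" and "m = nat \<lceil>b / 8\<rceil>"
  have m: "b / 8 \<le> real m" "real m \<le> b / 8 + 1" "1 \<le> m"
    using b unfolding m_def b_def n_def by linarith+
  have "t * (\<Sum>l<m - 1. 1 / quot (l + n)) = (\<Sum>l<m - 1. t / quot (l + n))"
    by (simp add: sum_distrib_left)
  also have "\<dots> \<le> (\<Sum>l<m - 1. 1)"
    using quot_gt[of t] by (intro sum_mono) (auto simp: n_def less_imp_le)
  finally have "b \<le> real (m - 1) + t * tail (n + (m - 1))"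
    using tail_split[of n "m - 1"] by (simp add: b_def distrib_left)
  \<comment> \<open>The right side is at least \<open>b - (m - 1)\<close>, hence at least
    \<open>7 * b / 8\<close>, while \<open>n + m \<le> b / 4 + 1 \<le> 3 * b / 8\<close> by
    \<open>8 \<le> b\<close>.\<close>
  then have "real (n + m) \<le> t * tail (n + m - 1)"
    using m b by (simp add: b_def n_def)
  then have "1 \<le> t * tail (n + m - 1) / real (n + m)" using m by simp
  then have "exp 1 * 1 \<le> exp 1 * (t * tail (n + m - 1) / real (n + m))"
    by (intro mult_left_mono) auto
  then have "exp 1 \<le> exp 1 * t * tail (n + m - 1) / real (n + m)" by (simp add: mult.assoc)
  then have "ln (exp 1) \<le> ln (exp 1 * t * tail (n + m - 1) / real (n + m))"
    by (intro ln_mono) auto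
  then have "real m * 1 \<le> real m * ln (exp 1 * t * tail (n + m - 1) / real (n + m))"
    by (intro mult_left_mono) auto
  then have "b / 8 \<le> real m * ln (exp 1 * t * tail (n + m - 1) / real (n + m))"
    using m by linarith
  moreover have "real m * ln (exp 1 * t * tail (n + m - 1) / real (n + m)) + (real n + omega t)
      \<le> omega_seq (Lseq M) (exp 1 * t)"
    using omega_seq_Lseq_ge[of "exp 1 * t" n "n + m"] ln_power_div_M_count[of t] assms m
    by (simp add: ln_exp_power_div_M flip: n_def)
  ultimately have "b / 8 \<le> omega_seq (Lseq M) (exp 1 * t)"
    using omega_nonneg[of t] by linarith
  then show ?thesis by (simp add: b_def n_def)
qed

text \<open>If the tail part does not dominate, it is at most \<open>8 * n + 8\<close>, so
  \<open>kap t\<close> is at most \<open>9 * (n + omega t) + 8\<close>;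
  \<open>count_plus_omega_le\<close> doubles the 9 to 18.\<close>

lemma kap_le:
  assumes "1 \<le> t"
  shows "kap t \<le> 18 * omega_seq (Lseq M) (exp 1 * t) + (9 * ln (M 2) + 8)"
proof -
  let ?w = "omega_seq (Lseq M) (exp 1 * t)"
  have w: "0 \<le> ?w" using assms by (intro omega_seq_Lseq_nonneg) simp
  have M2: "0 \<le> ln (M 2)" using M_ge_1[of 2] by simp
  note nw = count_plus_omega_le[OF assms] omega_nonneg[of t]
  show ?thesis
  proof (cases "8 \<le> t * tail (count t) \<and> 8 * real (count t) \<le> t * tail (count t)")
    case True
    then have "t * tail (count t) \<le> 8 * ?w" using assms by (intro tail_le_omega_seq_Lseq) auto
    with nw w M2 show ?thesis unfolding kap_def by linarith
  next
    case False
    then have "t * tail (count t) \<le> 8 * real (count t) + 8" by linarith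
    with nw w M2 show ?thesis unfolding kap_def by linarith
  qed
qed

section \<open>The log-convex minorant of \<open>Lseq M\<close>\<close>

text \<open>The expressions under the supremum are bounded by \<open>Lseq M k\<close>
  itself.\<close>

lemma lc_minorant_Lseq_ge:
  assumes "0 \<le> t"
  shows "t ^ k * exp (- omega_seq (Lseq M) t) \<le> lc_minorant (Lseq M) k"
proof -
  have "bdd_above ((\<lambda>t. t ^ k * exp (- omega_seq (Lseq M) t)) ` {0..})"
  proof (rule bdd_aboveI2)
    fix t :: real assume "t \<in> {0..}"
    then show "t ^ k * exp (- omega_seq (Lseq M) t) \<le> Lseq M k"
      using power_div_Lseq_le_exp_omega_seq[of t k] by (simp add: exp_minus field_simps)
  qed
  from cSUP_upper[OF _ this, of t] assms show ?thesis by (simp add: lc_minorant_def)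
qed

lemma lc_minorant_Lseq_le:
  assumes "\<And>t. 0 \<le> t \<Longrightarrow> t ^ k * exp (- omega_seq (Lseq M) t) \<le> c"
  shows "lc_minorant (Lseq M) k \<le> c"
  unfolding lc_minorant_def Lseq_0 mult_1 by (intro cSUP_least) (use assms in auto)

lemma lc_minorant_Lseq_pos: "0 < lc_minorant (Lseq M) k"
  using lc_minorant_Lseq_ge[of 1 k] by (simp add: less_le_trans[OF exp_gt_zero])

end

section \<open>The relation between sequences and the Young conjugate\<close>

text \<open>The \<open>k\<close>-th root turns \<open>D ^ k\<close> into \<open>D\<close> and
  \<open>C\<close> into at most \<open>max 1 C\<close>, so constant and geometric factors are
  harmless.\<close>

lemma seq_leI:
  assumes "0 \<le> C" "0 \<le> D"
    and "\<And>k. 0 \<le> M k" and "\<And>k. 0 < N k" and le: "\<And>k. M k \<le> C * D ^ k * N k"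
  shows "M \<preceq>\<^sub>s N"
  unfolding seq_le_def
proof (rule bdd_aboveI2)
  fix k :: nat assume "k \<in> {1..}"
  then have k: "0 < real k" "1 / real k \<le> 1" by auto
  have "M k / N k \<le> C * D ^ k" using le[of k] assms(4)[of k] by (simp add: divide_simps)
  then have "(M k / N k) powr (1 / real k) \<le> (C * D ^ k) powr (1 / real k)"
    using assms(3)[of k] assms(4)[of k] by (intro powr_mono2) auto
  also have "\<dots> = C powr (1 / real k) * (D ^ k) powr (1 / real k)"
    by (rule powr_mult)
  also have "(D ^ k) powr (1 / real k) = D"
    using k assms(2) by (cases "D = 0") (simp_all add: powr_powr flip: powr_realpow)
  also have "C powr (1 / real k) \<le> max 1 C powr (1 / real k)"
    using k assms(1) by (intro powr_mono2) auto
  also have "max 1 C powr (1 / real k) \<le> max 1 C powr 1"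
    using k by (intro powr_mono) auto
  finally show "(M k / N k) powr (1 / real k) \<le> max 1 C * D"
    using assms(2) by (simp add: mult_right_mono)
qed

lemma phi_star_le:
  assumes "\<And>y. 0 \<le> y \<Longrightarrow> x * y - w (exp y) \<le> c"
  shows "phi_star w x \<le> c"
  unfolding phi_star_def using assms by (intro cSUP_least) auto

text \<open>Boundedness is a premise because the lemma is also applied to
  \<open>\<kappa>' \<alpha>\<close>, where the bound comes from the comparison with the family
  \<open>L\<close>.\<close>

lemma phi_star_ge:
  assumes "\<And>y. 0 \<le> y \<Longrightarrow> x * y - w (exp y) \<le> c" and "0 \<le> y"
  shows "x * y - w (exp y) \<le> phi_star w x"
  unfolding phi_star_def using assms by (intro cSUP_upper bdd_aboveI2[where M = c]) auto

section \<open>The weight matrix of a normalized pre-weight function\<close>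

locale normalized_pre_weight =
  fixes w :: "real \<Rightarrow> real"
  assumes pre_weight: "pre_weight w" and normalized: "normalized w"
begin

lemma w_nonneg: "0 \<le> t \<Longrightarrow> 0 \<le> w t"
  using pre_weight by (simp add: pre_weight_def)

lemma w_1: "w 1 = 0"
  using normalized by (simp add: normalized_def)

text \<open>Consequence of \<open>ln t = o(w t)\<close>: with the small constant
  \<open>1 / (\<bar>x\<bar> + 1)\<close>, \<open>w (exp y)\<close> exceeds
  \<open>\<bar>x\<bar> * y\<close> once \<open>exp y\<close> reaches \<open>u\<close>, and smaller
  \<open>y\<close> are at most \<open>ln u\<close>.\<close>

lemma young_bounded:
  obtains c where "\<And>y. 0 \<le> y \<Longrightarrow> x * y - w (exp y) \<le> c"
proof -
  have "(\<lambda>t. ln t) \<in> o[at_top](w)" using pre_weight by (simp add: pre_weight_def)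
  then have "\<forall>\<^sub>F t in at_top. norm (ln t) \<le> (1 / (\<bar>x\<bar> + 1)) * norm (w t)"
    by (rule landau_o.smallD) simp
  then obtain t0 where t0: "\<And>t. t0 \<le> t \<Longrightarrow> \<bar>ln t\<bar> \<le> (1 / (\<bar>x\<bar> + 1)) * \<bar>w t\<bar>"
    by (auto simp: eventually_at_top_linorder)
  define u where "u = max t0 1"
  show ?thesis
  proof (rule that)
    fix y :: real assume y: "0 \<le> y"
    have "x * y \<le> \<bar>x\<bar> * y" using y by (intro mult_right_mono) auto
    moreover have "0 \<le> \<bar>x\<bar> * ln u" by (simp add: u_def)
    moreover have "\<bar>x\<bar> * y \<le> w (exp y) \<or> \<bar>x\<bar> * y \<le> \<bar>x\<bar> * ln u"
    proof (cases "u \<le> exp y")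
      case True
      then have "y \<le> (1 / (\<bar>x\<bar> + 1)) * w (exp y)"
        using t0[of "exp y"] y w_nonneg[of "exp y"] by (simp add: u_def)
      then have "(\<bar>x\<bar> + 1) * y \<le> (\<bar>x\<bar> + 1) * ((1 / (\<bar>x\<bar> + 1)) * w (exp y))"
        by (intro mult_left_mono) auto
      also have "\<dots> = w (exp y)" by simp
      finally show ?thesis using y by (simp add: distrib_right)
    next
      case False
      then have "ln (exp y) \<le> ln u" by (intro ln_mono) auto
      then show ?thesis by (simp add: mult_left_mono)
    qed
    ultimately show "x * y - w (exp y) \<le> \<bar>x\<bar> * ln u"
      using w_nonneg[of "exp y"] by auto
  qed
qed

lemma young: "0 \<le> y \<Longrightarrow> x * y - w (exp y) \<le> phi_star w x"
  by (metis young_bounded phi_star_ge)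

lemma phi_star_0: "phi_star w 0 = 0"
proof (rule antisym)
  show "phi_star w 0 \<le> 0" by (rule phi_star_le) (simp add: w_nonneg)
  show "0 \<le> phi_star w 0" using young[of 0 0] by (simp add: w_1)
qed

lemma phi_star_mono:
  assumes "x \<le> z"
  shows "phi_star w x \<le> phi_star w z"
proof (rule phi_star_le)
  fix y :: real assume "0 \<le> y"
  with assms have "x * y \<le> z * y" by (rule mult_right_mono)
  then show "x * y - w (exp y) \<le> phi_star w z" using young[of y z] \<open>0 \<le> y\<close> by simp
qed

text \<open>A supremum of affine functions is convex; log-convexity of \<open>Mx w x\<close> needs
  only the midpoint case.\<close>

lemma phi_star_midpoint: "2 * phi_star w ((x + z) / 2) \<le> phi_star w x + phi_star w z"
proof -
  have "phi_star w ((x + z) / 2) \<le> (phi_star w x + phi_star w z) / 2"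
  proof (rule phi_star_le)
    fix y :: real assume "0 \<le> y"
    then show "(x + z) / 2 * y - w (exp y) \<le> (phi_star w x + phi_star w z) / 2"
      using young[of y x] young[of y z] by (simp add: field_simps)
  qed
  then show ?thesis by simp
qed

lemma log_convex_sequence_Mx:
  assumes "0 < x"
  shows "log_convex_sequence (Mx w x)"
proof
  show "Mx w x 0 = 1" by (simp add: Mx_def phi_star_0)
  show "Mx w x k \<le> Mx w x (Suc k)" for k
    using assms unfolding Mx_def
    by (intro iffD2[OF exp_le_cancel_iff] divide_right_mono phi_star_mono mult_left_mono) auto
  fix k
  have "(x * real k + x * real (Suc (Suc k))) / 2 = x * real (Suc k)" by (simp add: algebra_simps)
  then have "2 * phi_star w (x * real (Suc k)) / x
      \<le> (phi_star w (x * real k) + phi_star w (x * real (Suc (Suc k)))) / x"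
    using phi_star_midpoint[of "x * real k" "x * real (Suc (Suc k))"] assms
    by (intro divide_right_mono) auto
  then show "(Mx w x (Suc k))\<^sup>2 \<le> Mx w x k * Mx w x (Suc (Suc k))"
    unfolding Mx_def by (simp add: power2_eq_square add_divide_distrib flip: exp_add)
qed

lemma ln_power_div_Mx: "0 < t \<Longrightarrow> ln (t ^ k / Mx w x k) = real k * ln t - phi_star w (x * real k) / x"
  by (simp add: Mx_def ln_div ln_realpow)

lemma ln_power_div_Mx_le:
  assumes "0 < x" "1 \<le> t"
  shows "ln (t ^ k / Mx w x k) \<le> w t / x"
proof -
  have "x * real k * ln t - w t \<le> phi_star w (x * real k)"
    using young[of "ln t" "x * real k"] assms by simp
  then have "(x * real k * ln t - w t) / x \<le> phi_star w (x * real k) / x"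
    using assms by (intro divide_right_mono) auto
  then show ?thesis using assms by (simp add: ln_power_div_Mx diff_divide_distrib)
qed

text \<open>As \<open>1 / quot l\<close> is at most 1, it equals the integral of
  \<open>log_plus (s / quot l) / s\<^sup>2\<close> over \<open>{1..}\<close>. Partial sums of these
  integrands are at most \<open>w s / (x * s\<^sup>2)\<close>, so the non-quasianalytic integral
  bounds all partial sums of the reciprocals.\<close>

lemma weight_sequence_Mx:
  assumes "0 < x" and nq: "non_quasianalytic w"
  shows "weight_sequence (Mx w x)"
proof -
  interpret log_convex_sequence "Mx w x" using assms(1) by (rule log_convex_sequence_Mx)
  let ?I = "integral {0..} (\<lambda>t. w t / (1 + t\<^sup>2))"
  have int_w: "((\<lambda>t. 2 / x * (w t / (1 + t\<^sup>2))) has_integral 2 / x * ?I) {0..}"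
    using nq unfolding non_quasianalytic_def by (intro has_integral_mult_right integrable_integral)
  have "(\<Sum>l<N. 1 / quot l) \<le> 2 / x * ?I" for N
  proof -
    let ?f = "\<lambda>s. \<Sum>l<N. log_plus (1 / quot l * s) / s\<^sup>2"
    have "(?f has_integral (\<Sum>l<N. kappa_log_plus (1 / quot l))) {1..}"
      by (intro has_integral_sum has_integral_log_plus) auto
    moreover have "kappa_log_plus (1 / quot l) = 1 / quot l" for l
      using quot_ge_1[of l] by (cases "quot l = 1") (auto simp: kappa_log_plus_def divide_simps)
    ultimately have "((\<lambda>s. if s \<in> {1..} then ?f s else 0) has_integral (\<Sum>l<N. 1 / quot l)) {0..}"
      by (intro iffD2[OF has_integral_restrict]) auto
    then show ?thesis using int_w
    proof (rule has_integral_le)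
      fix s :: real assume s: "s \<in> {0..}"
      show "(if s \<in> {1..} then ?f s else 0) \<le> 2 / x * (w s / (1 + s\<^sup>2))"
      proof (cases "1 \<le> s")
        case True
        have "?f s = (\<Sum>l<N. log_plus (s / quot l)) / s\<^sup>2" by (simp add: sum_divide_distrib)
        also have "\<dots> \<le> w s / x / s\<^sup>2"
          using True assms by (intro divide_right_mono sum_log_plus_le ln_power_div_Mx_le) auto
        also have "\<dots> = w s / x * (1 / s\<^sup>2)" by simp
        \<comment> \<open>\<open>1 / s\<^sup>2 \<le> 2 / (1 + s\<^sup>2)\<close> for
          \<open>s \<ge> 1\<close>, the origin of the factor 2.\<close>
        also have "\<dots> \<le> w s / x * (2 / (1 + s\<^sup>2))"
          using True assms w_nonneg[of s]
          by (intro mult_left_mono) (auto simp: divide_simps one_le_power add_pos_nonneg)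
        finally show ?thesis using True by (simp add: mult_ac)
      next
        case False
        then show ?thesis using s w_nonneg[of s] assms by simp
      qed
    qed
  qed
  then have "summable (\<lambda>l. 1 / quot l)"
    by (intro bounded_imp_summable[where B = "2 / x * ?I"])
       (simp_all only: flip: lessThan_Suc_atMost, simp add: less_imp_le)
  then show ?thesis by unfold_locales (simp add: quot_def)
qed

text \<open>The \<open>n\<close>-th power of \<open>Mx w (n * x) k\<close> is
  \<open>Mx w x (n * k)\<close>. So \<open>n\<close> times the associated function of the former
  sequence is a supremum over part of the terms of the latter, and integration preserves the
  inequality.\<close>

lemma kap_Mx_mult:
  assumes "0 < x" "0 < n" "non_quasianalytic w" "0 < t"
  shows "real n * weight_sequence.kap (Mx w (real n * x)) t \<le> weight_sequence.kap (Mx w x) t"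
proof -
  interpret A: weight_sequence "Mx w x" using assms by (intro weight_sequence_Mx) auto
  interpret B: weight_sequence "Mx w (real n * x)" using assms by (intro weight_sequence_Mx) auto
  have le: "real n * B.omega s \<le> A.omega s" if "0 < s" for s
  proof -
    let ?k = "B.count s"
    have "real n * B.omega s = real n * (real ?k * ln s - phi_star w (real n * x * real ?k) / (real n * x))"
      using that by (simp flip: B.ln_power_div_M_count add: ln_power_div_Mx)
    also have "\<dots> = ln (s ^ (n * ?k) / Mx w x (n * ?k))"
      using that assms by (simp add: ln_power_div_Mx field_simps)
    also have "\<dots> \<le> A.omega s" using that by (rule A.ln_power_div_M_le_omega)
    finally show ?thesis .
  qed
  have "((\<lambda>s. real n * (B.omega (t * s) / s\<^sup>2)) has_integral real n * B.kap t) {1..}"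
    using assms by (intro has_integral_mult_right B.has_integral_kap)
  moreover have "((\<lambda>s. A.omega (t * s) / s\<^sup>2) has_integral A.kap t) {1..}"
    using assms by (intro A.has_integral_kap)
  ultimately show ?thesis
  proof (rule has_integral_le)
    fix s :: real assume "s \<in> {1..}"
    then have "real n * B.omega (t * s) \<le> A.omega (t * s)" using assms by (intro le) simp
    then show "real n * (B.omega (t * s) / s\<^sup>2) \<le> A.omega (t * s) / s\<^sup>2"
      by (simp add: divide_right_mono)
  qed
qed

end

section \<open>Comparison of the two families\<close>

lemma exp_diff_power:
  fixes y c :: real
  shows "exp (real k * y - c) = exp y ^ k * exp (- c)"
  by (simp add: exp_diff exp_minus exp_of_nat_mult divide_inverse)

text \<open>The bounded distance of \<open>\<kappa>' \<alpha>\<close> from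
  \<open>kappa_alpha \<omega> \<alpha>\<close> changes the sequences only by constant factors, which
  the \<open>k\<close>-th root discards.\<close>

theorem theorem5p5:
  fixes \<omega> :: "real \<Rightarrow> real" and \<kappa>' :: "real \<Rightarrow> real \<Rightarrow> real"
  assumes "weight_fun \<omega>" and "non_quasianalytic \<omega>" and "normalized \<omega>"
    and "\<And>\<alpha>. \<alpha> > 0 \<Longrightarrow> normalized (\<kappa>' \<alpha>)"
    and "\<And>\<alpha>. \<alpha> > 0 \<Longrightarrow> \<exists>C. \<forall>t\<ge>0. \<bar>\<kappa>' \<alpha> t - kappa_alpha \<omega> \<alpha> t\<bar> \<le> C"
  shows "R_equiv (Kfam \<kappa>') (Lfam \<omega>)"
proof -
  interpret normalized_pre_weight \<omega>
    using assms(1,3) by unfold_locales (simp_all add: weight_fun_def)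
  have ws: "weight_sequence (Mx \<omega> \<alpha>)" if "0 < \<alpha>" for \<alpha>
    using that assms(2) by (rule weight_sequence_Mx)
  define K where "K = (\<lambda>\<alpha> j. exp (phi_star (\<kappa>' \<alpha>) (real j)))"
  define L where "L = (\<lambda>\<beta>. lc_minorant (Lseq (Mx \<omega> \<beta>)))"
  have Kfam: "Kfam \<kappa>' = {K \<alpha> | \<alpha>. 0 < \<alpha>}" by (simp add: Kfam_def K_def)
  have Lfam: "Lfam \<omega> = {L \<beta> | \<beta>. 0 < \<beta>}" by (auto simp: Lfam_def Mfam_def L_def)
  have L_pos: "0 < L \<beta> k" if "0 < \<beta>" for \<beta> k
    unfolding L_def by (rule weight_sequence.lc_minorant_Lseq_pos[OF ws[OF that]])
  \<comment> \<open>Used twice: the supremum over \<open>y\<close> gives \<open>K_le\<close>, and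
    the bound makes \<open>phi_star (\<kappa>' \<alpha>)\<close> a genuine supremum in
    \<open>young_K\<close>. The parameter \<open>2 * \<alpha>\<close> absorbs the factor 2 of
    \<open>omega_seq_Lseq_le\<close>.\<close>
  have upper: "\<exists>C. \<forall>j y. 0 \<le> y \<longrightarrow> real j * y - \<kappa>' \<alpha> (exp y) \<le> ln (L (2 * \<alpha>) j) + C"
    if \<alpha>: "0 < \<alpha>" for \<alpha>
  proof -
    interpret A: weight_sequence "Mx \<omega> \<alpha>" using ws \<alpha> by simp
    interpret B: weight_sequence "Mx \<omega> (2 * \<alpha>)" using ws \<alpha> by simp
    obtain C where C: "\<And>t. 0 \<le> t \<Longrightarrow> \<bar>\<kappa>' \<alpha> t - kappa_alpha \<omega> \<alpha> t\<bar> \<le> C"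
      using assms(5)[OF \<alpha>] by blast
    have "real j * y - \<kappa>' \<alpha> (exp y) \<le> ln (L (2 * \<alpha>) j) + C" if y: "0 \<le> y" for j y
    proof -
      let ?o = "omega_seq (Lseq (Mx \<omega> (2 * \<alpha>))) (exp y)"
      have "?o \<le> 2 * B.kap (exp y)" by (rule B.omega_seq_Lseq_le) simp
      also have "\<dots> \<le> A.kap (exp y)" using kap_Mx_mult[of \<alpha> 2 "exp y"] \<alpha> assms(2) by simp
      also have "\<dots> \<le> kappa_alpha \<omega> \<alpha> (exp y)"
        unfolding kappa_alpha_def using y by (intro A.kappa_omega_tilde_bounds) simp
      also have "\<dots> \<le> \<kappa>' \<alpha> (exp y) + C" using C[of "exp y"] by simp
      finally have "real j * y - \<kappa>' \<alpha> (exp y) \<le> (real j * y - ?o) + C" by simp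
      also have "exp (real j * y - ?o) \<le> L (2 * \<alpha>) j"
        unfolding exp_diff_power L_def by (rule B.lc_minorant_Lseq_ge) simp
      then have "real j * y - ?o \<le> ln (L (2 * \<alpha>) j)"
        using L_pos[of "2 * \<alpha>" j] \<alpha> by (simp add: ln_ge_iff)
      finally show ?thesis by simp
    qed
    then show ?thesis by blast
  qed
  have K_le: "K \<alpha> \<preceq>\<^sub>s L (2 * \<alpha>)" if \<alpha>: "0 < \<alpha>" for \<alpha>
  proof -
    obtain C where C: "\<And>j y. 0 \<le> y \<Longrightarrow> real j * y - \<kappa>' \<alpha> (exp y) \<le> ln (L (2 * \<alpha>) j) + C"
      using upper[OF \<alpha>] by blast
    have "K \<alpha> j \<le> exp C * 1 ^ j * L (2 * \<alpha>) j" for j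
    proof -
      have "phi_star (\<kappa>' \<alpha>) (real j) \<le> ln (L (2 * \<alpha>) j) + C" by (rule phi_star_le) (rule C)
      then have "K \<alpha> j \<le> exp (ln (L (2 * \<alpha>) j) + C)" by (simp add: K_def)
      then show ?thesis using L_pos[of "2 * \<alpha>" j] \<alpha> by (simp add: exp_add mult.commute)
    qed
    then show ?thesis
      using L_pos \<alpha> by (intro seq_leI[of "exp C" 1]) (auto simp: K_def)
  qed
  \<comment> \<open>Here 36 is 2 from \<open>kappa_omega_tilde_bounds\<close> times 18 from
    \<open>kap_le\<close>.\<close>
  have L_le: "L \<beta> \<preceq>\<^sub>s K (36 * \<beta>)" if \<beta>: "0 < \<beta>" for \<beta>
  proof -
    interpret A: weight_sequence "Mx \<omega> (36 * \<beta>)" using ws \<beta> by simp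
    interpret B: weight_sequence "Mx \<omega> \<beta>" using ws \<beta> by simp
    let ?o = "omega_seq (Lseq (Mx \<omega> \<beta>))" and ?k = "\<kappa>' (36 * \<beta>)"
    have young_K: "exp (real j * y - ?k (exp y)) \<le> K (36 * \<beta>) j" if "0 \<le> y" for j y
      using upper[of "36 * \<beta>"] \<beta> phi_star_ge[OF _ that, of "real j" ?k] by (auto simp: K_def)
    obtain C where C: "\<And>t. 0 \<le> t \<Longrightarrow> \<bar>?k t - kappa_alpha \<omega> (36 * \<beta>) t\<bar> \<le> C"
      using assms(5)[of "36 * \<beta>"] \<beta> by auto
    \<comment> \<open>The maximum with 0 ensures \<open>exp c \<ge> 1\<close>, needed for small
      \<open>s\<close> below.\<close>
    define c where "c = max 0 ((9 * ln (Mx \<omega> \<beta> 2) + 8) / 18 + (ln 2 + ln (Mx \<omega> (36 * \<beta>) 2)) + C)"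
    have k_le: "?k t \<le> ?o (exp 1 * t) + c" if t: "1 \<le> t" for t
    proof -
      have "?k t \<le> kappa_alpha \<omega> (36 * \<beta>) t + C" using C[of t] t by simp
      moreover have "kappa_alpha \<omega> (36 * \<beta>) t \<le> 2 * A.kap t + (ln 2 + ln (Mx \<omega> (36 * \<beta>) 2))"
        unfolding kappa_alpha_def using t by (rule A.kappa_omega_tilde_bounds)
      moreover have "36 * A.kap t \<le> B.kap t" using kap_Mx_mult[of \<beta> 36 t] \<beta> t assms(2) by simp
      moreover have "B.kap t \<le> 18 * ?o (exp 1 * t) + (9 * ln (Mx \<omega> \<beta> 2) + 8)"
        using t by (rule B.kap_le)
      moreover have "(9 * ln (Mx \<omega> \<beta> 2) + 8) / 18 + (ln 2 + ln (Mx \<omega> (36 * \<beta>) 2)) + C \<le> c"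
        by (simp add: c_def)
      ultimately show ?thesis by (simp add: add_divide_distrib)
    qed
    \<comment> \<open>Take \<open>y = 0\<close> and use that the normalized \<open>?k\<close>
      vanishes at 1.\<close>
    have K_ge_1: "1 \<le> K (36 * \<beta>) j" for j
      using young_K[of 0 j] assms(4)[of "36 * \<beta>"] \<beta> by (simp add: normalized_def)
    have "L \<beta> j \<le> exp c * exp 1 ^ j * K (36 * \<beta>) j" for j
      unfolding L_def
    proof (rule B.lc_minorant_Lseq_le)
      fix s :: real assume s: "0 \<le> s"
      show "s ^ j * exp (- ?o s) \<le> exp c * exp 1 ^ j * K (36 * \<beta>) j"
      \<comment> \<open>For \<open>s \<ge> exp 1\<close> the substitution
        \<open>s = exp 1 * t\<close> reaches the range \<open>t \<ge> 1\<close> of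
        \<open>k_le\<close> and produces the factor \<open>exp 1 ^ j\<close>. For smaller
        \<open>s\<close> that factor alone suffices, as the other factors on the right have product
        at least 1.\<close>
      proof (cases "exp 1 \<le> s")
        case True
        define t where "t = s / exp 1"
        have t: "1 \<le> t" "s = exp 1 * t" using True by (simp_all add: t_def)
        have "exp (- ?o s) \<le> exp c * exp (- ?k t)"
          using k_le[OF t(1)] t(2) by (simp flip: exp_add)
        then have "s ^ j * exp (- ?o s) \<le> s ^ j * (exp c * exp (- ?k t))"
          using s by (intro mult_left_mono) auto
        also have "\<dots> = exp c * exp 1 ^ j * (t ^ j * exp (- ?k t))"
          by (simp add: t(2) power_mult_distrib)
        also have "t ^ j * exp (- ?k t) \<le> K (36 * \<beta>) j"
          using young_K[of "ln t" j] t by (simp add: exp_diff_power)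
        finally show ?thesis by simp
      next
        case False
        then have "s ^ j \<le> exp 1 ^ j" using s by (intro power_mono) auto
        moreover have "exp (- ?o s) \<le> 1" using B.omega_seq_Lseq_nonneg[OF s] by simp
        moreover have "1 \<le> exp c * K (36 * \<beta>) j"
          using mult_mono[of 1 "exp c" 1 "K (36 * \<beta>) j"] K_ge_1[of j] by (simp add: c_def)
        ultimately have "s ^ j * exp (- ?o s) \<le> exp 1 ^ j * 1" and "exp 1 ^ j * 1 \<le> exp 1 ^ j * (exp c * K (36 * \<beta>) j)"
          by (intro mult_mono mult_left_mono; simp)+
        then have "s ^ j * exp (- ?o s) \<le> exp 1 ^ j * (exp c * K (36 * \<beta>) j)" by (rule order_trans)
        also have "\<dots> = exp c * exp 1 ^ j * K (36 * \<beta>) j" by (simp only: mult_ac)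
        finally show ?thesis .
      qed
    qed
    then show ?thesis
      using L_pos[OF \<beta>] by (intro seq_leI[of "exp c" "exp 1"]) (auto simp: K_def less_imp_le)
  qed
  show ?thesis
    unfolding R_equiv_def Kfam Lfam
  proof safe
    fix \<alpha> :: real assume "0 < \<alpha>"
    then show "\<exists>N\<in>{L \<beta> | \<beta>. 0 < \<beta>}. K \<alpha> \<preceq>\<^sub>s N"
      using K_le by (intro bexI[of _ "L (2 * \<alpha>)"]) auto
  next
    fix \<beta> :: real assume "0 < \<beta>"
    then show "\<exists>M\<in>{K \<alpha> | \<alpha>. 0 < \<alpha>}. L \<beta> \<preceq>\<^sub>s M"
      using L_le by (intro bexI[of _ "K (36 * \<beta>)"]) auto
  qed
qed

end
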